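(* Let $n\ge 2$, $\mathfrak g=sl_n(\mathbb C)$ with standard Chevalley generators $e_i,f_i$ ($1\le i\le n-1$), and let $\mathbf a=(a_1,\dots,a_{n-1})\in\mathbb C^{n-1}$. Put $u_i:=e_i+a_i[e_i,f_i]-a_i^2f_i$ and $$g_{\mathbf a}:=e^{a_{n-1}f_{n-1}}\cdots e^{a_2f_2}e^{a_1f_1}\in SL_n(\mathbb C).$$ Then for $i=1,\dots,n-1$, $$g_{\mathbf a}\,u_i\,g_{\mathbf a}^{-1}=e_i+b_{i-1}f_{i-1},$$ where $b_j:=-a_ja_{j+1}$, with the convention $f_0=0$, $a_0=0$.
   Context: The standard Chevalley generators of $sl_n$ are the matrix units $e_i=E_{i,i+1}$, $f_i=E_{i+1,i}$. *)

theory Defs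
  imports Complex_Main "Jordan_Normal_Form.Determinant" "Jordan_Normal_Form.Gauss_Jordan_Elimination"
begin

text \<open>Rows and columns of \<open>mat\<close> are numbered from 0; the indices \<open>i\<close>, \<open>j\<close> of the matrix units
  \<open>E\<^sub>i\<^sub>j\<close> and of the Chevalley generators are numbered from 1.\<close>

definition matrix_unit :: "nat \<Rightarrow> nat \<Rightarrow> nat \<Rightarrow> complex mat" where
  "matrix_unit n i j = mat n n (\<lambda>(r, c). if Suc r = i \<and> Suc c = j then 1 else 0)"

definition chevalley_e :: "nat \<Rightarrow> nat \<Rightarrow> complex mat" where
  "chevalley_e n i = matrix_unit n i (i + 1)"

definition chevalley_f :: "nat \<Rightarrow> nat \<Rightarrow> complex mat" where
  "chevalley_f n i = (if i = 0 then 0\<^sub>m n n else matrix_unit n (i + 1) i)"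

definition lie_bracket :: "complex mat \<Rightarrow> complex mat \<Rightarrow> complex mat" where
  "lie_bracket A B = A * B - B * A"

text \<open>The series \<open>\<Sum>k. A\<^sup>k / k!\<close>, summed entry by entry; it converges for every square matrix.\<close>

definition mat_exp :: "complex mat \<Rightarrow> complex mat" where
  "mat_exp A = mat (dim_row A) (dim_row A) (\<lambda>(r, c). \<Sum>k. (A ^\<^sub>m k) $$ (r, c) / fact k)"

definition special_linear_group :: "nat \<Rightarrow> complex mat set" where
  "special_linear_group n = {A \<in> carrier_mat n n. det A = 1}"

definition u_elt :: "nat \<Rightarrow> (nat \<Rightarrow> complex) \<Rightarrow> nat \<Rightarrow> complex mat" where
  "u_elt n a i =
    chevalley_e n i + a i \<cdot>\<^sub>m lie_bracket (chevalley_e n i) (chevalley_f n i)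
      - (a i)\<^sup>2 \<cdot>\<^sub>m chevalley_f n i"

text \<open>New factors are multiplied on the left, so that the factor with the largest index is
  leftmost.\<close>

primrec exp_f_prod :: "nat \<Rightarrow> (nat \<Rightarrow> complex) \<Rightarrow> nat \<Rightarrow> complex mat" where
  "exp_f_prod n a 0 = 1\<^sub>m n"
| "exp_f_prod n a (Suc k) = mat_exp (a (Suc k) \<cdot>\<^sub>m chevalley_f n (Suc k)) * exp_f_prod n a k"

definition g_elt :: "nat \<Rightarrow> (nat \<Rightarrow> complex) \<Rightarrow> complex mat" where
  "g_elt n a = exp_f_prod n a (n - 1)"

definition b_coeff :: "(nat \<Rightarrow> complex) \<Rightarrow> nat \<Rightarrow> complex" where
  "b_coeff a j = - a j * a (j + 1)"

end

theory Submission
  imports Defs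
begin

text \<open>Since \<open>f\<^sub>k\<^sup>2 = 0\<close>, each factor \<open>exp (a\<^sub>k f\<^sub>k)\<close> is an elementary matrix. The first \<open>i - 2\<close>
  factors commute with \<open>u\<^sub>i\<close>; the factor with index \<open>i - 1\<close> turns \<open>u\<^sub>i\<close> into
  \<open>u\<^sub>i - a\<^sub>i\<^sub>-\<^sub>1 a\<^sub>i f\<^sub>i\<^sub>-\<^sub>1 + a\<^sub>i\<^sub>-\<^sub>1 a\<^sub>i\<^sup>2 E\<^sub>i\<^sub>+\<^sub>1\<^sub>,\<^sub>i\<^sub>-\<^sub>1\<close>; the factor with index \<open>i\<close> turns this into
  \<open>e\<^sub>i + b\<^sub>i\<^sub>-\<^sub>1 f\<^sub>i\<^sub>-\<^sub>1\<close>, because \<open>u\<^sub>i\<close> is the conjugate of \<open>e\<^sub>i\<close> by \<open>exp (- a\<^sub>i f\<^sub>i)\<close>; and the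
  remaining factors commute with the result.\<close>

lemma matrix_unit_carrier [simp]: "matrix_unit n i j \<in> carrier_mat n n"
  by (simp add: matrix_unit_def)

lemma dim_matrix_unit [simp]:
  "dim_row (matrix_unit n i j) = n" "dim_col (matrix_unit n i j) = n"
  by (simp_all add: matrix_unit_def)

lemma index_matrix_unit [simp]:
  "r < n \<Longrightarrow> c < n \<Longrightarrow>
    matrix_unit n i j $$ (r, c) = (if Suc r = i \<and> Suc c = j then 1 else 0)"
  by (simp add: matrix_unit_def)

lemma matrix_unit_mult:
  assumes "1 \<le> j" "j \<le> n"
  shows "matrix_unit n i j * matrix_unit n k l = (if j = k then matrix_unit n i l else 0\<^sub>m n n)"
proof (rule eq_matI)
  fix r c
  assume "r < dim_row (if j = k then matrix_unit n i l else 0\<^sub>m n n)"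
    and "c < dim_col (if j = k then matrix_unit n i l else 0\<^sub>m n n)"
  then have rc: "r < n" "c < n"
    by (auto split: if_splits)
  have "(matrix_unit n i j * matrix_unit n k l) $$ (r, c) =
      (\<Sum>m\<in>{0..<n}. matrix_unit n i j $$ (r, m) * matrix_unit n k l $$ (m, c))"
    using rc by (simp add: scalar_prod_def)
  \<comment> \<open>Only the zero-based position \<open>j - 1\<close> contributes; the bounds on
    \<open>j\<close> make it a valid index.\<close>
  also have "\<dots> = (\<Sum>m\<in>{0..<n}. if m = j - 1
      then (if Suc r = i \<and> j = k \<and> Suc c = l then 1 else 0) else 0)"
    using rc assms by (intro sum.cong) auto
  also have "\<dots> = (if j = k then matrix_unit n i l else 0\<^sub>m n n) $$ (r, c)"
    using rc assms by auto
  finally show "(matrix_unit n i j * matrix_unit n k l) $$ (r, c) =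
      (if j = k then matrix_unit n i l else 0\<^sub>m n n) $$ (r, c)" .
qed auto

lemma mat_exp_square_zero:
  assumes A: "A \<in> carrier_mat n n" and sq: "A * A = 0\<^sub>m n n"
  shows "mat_exp A = 1\<^sub>m n + A"
proof (rule eq_matI)
  fix r c
  assume "r < dim_row (1\<^sub>m n + A)" and "c < dim_col (1\<^sub>m n + A)"
  then have rc: "r < n" "c < n"
    using A by auto
  have pow: "A ^\<^sub>m Suc (Suc k) = 0\<^sub>m n n" for k
    using A sq by (induction k) auto
  have "(\<Sum>k. (A ^\<^sub>m k) $$ (r, c) / fact k) = (\<Sum>k<2. (A ^\<^sub>m k) $$ (r, c) / fact k)"
  proof (rule suminf_finite)
    fix k :: nat
    assume "k \<notin> {..<2}"
    then obtain m where "k = Suc (Suc m)"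
      by (metis add_2_eq_Suc lessThan_iff less_eqE not_less)
    then show "(A ^\<^sub>m k) $$ (r, c) / fact k = 0"
      using rc pow[of m] by simp
  qed simp
  also have "\<dots> = (1\<^sub>m n + A) $$ (r, c)"
    using rc A by (auto simp: numeral_2_eq_2)
  finally show "mat_exp A $$ (r, c) = (1\<^sub>m n + A) $$ (r, c)"
    using rc A by (simp add: mat_exp_def)
qed (use A in \<open>auto simp: mat_exp_def\<close>)

text \<open>The unit with 1-based position \<open>(k + 1, k)\<close> sits at row \<open>k\<close>,
  column \<open>k - 1\<close> of the 0-based matrix.\<close>

lemma mat_exp_chevalley_f:
  assumes "1 \<le> k" "k < n"
  shows "mat_exp (t \<cdot>\<^sub>m chevalley_f n k) = addrow_mat n t k (k - 1)"
proof -
  have sq: "chevalley_f n k * chevalley_f n k = 0\<^sub>m n n"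
    using assms by (simp add: chevalley_f_def matrix_unit_mult)
  have f: "chevalley_f n k \<in> carrier_mat n n"
    by (simp add: chevalley_f_def)
  have "(t \<cdot>\<^sub>m chevalley_f n k) * (t \<cdot>\<^sub>m chevalley_f n k) = 0\<^sub>m n n"
    using f sq by (simp add: mult_smult_distrib[of _ n n _ n] mult_smult_assoc_mat[of _ n n _ n])
  then have "mat_exp (t \<cdot>\<^sub>m chevalley_f n k) = 1\<^sub>m n + t \<cdot>\<^sub>m chevalley_f n k"
    using f by (intro mat_exp_square_zero) auto
  also have "\<dots> = addrow_mat n t k (k - 1)"
    using assms by (intro eq_matI) (auto simp: chevalley_f_def)
  finally show ?thesis .
qed

lemma exp_f_prod_special_linear:
  "m < n \<Longrightarrow> exp_f_prod n a m \<in> special_linear_group n"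
  by (induction m)
    (auto simp: special_linear_group_def mat_exp_chevalley_f det_addrow_mat det_mult[of _ n])

lemma index_u_elt:
  assumes "1 \<le> i" "i < n" "r < n" "c < n"
  shows "u_elt n a i $$ (r, c) =
      (if Suc r = i \<and> c = i then 1
       else if Suc r = i \<and> Suc c = i then a i
       else if r = i \<and> c = i then - a i
       else if r = i \<and> Suc c = i then - (a i)\<^sup>2 else 0)"
proof -
  have "lie_bracket (chevalley_e n i) (chevalley_f n i) =
      matrix_unit n i i - matrix_unit n (Suc i) (Suc i)"
    using assms by (simp add: lie_bracket_def chevalley_e_def chevalley_f_def matrix_unit_mult)
  then show ?thesis
    using assms by (simp add: u_elt_def chevalley_e_def chevalley_f_def)
qed

lemma u_elt_carrier [simp]: "u_elt n a i \<in> carrier_mat n n"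
  by (auto simp: u_elt_def lie_bracket_def chevalley_e_def chevalley_f_def)

text \<open>At \<open>i = 1\<close> this is \<open>u\<^sub>1\<close> itself, as \<open>Suc (Suc c) = 1\<close> is impossible.\<close>

definition u_mid :: "nat \<Rightarrow> (nat \<Rightarrow> complex) \<Rightarrow> nat \<Rightarrow> complex mat" where
  "u_mid n a i = u_elt n a i + mat n n (\<lambda>(r, c).
     if Suc r = i \<and> Suc (Suc c) = i then - a (i - 1) * a i
     else if r = i \<and> Suc (Suc c) = i then a (i - 1) * (a i)\<^sup>2 else 0)"

definition u_end :: "nat \<Rightarrow> (nat \<Rightarrow> complex) \<Rightarrow> nat \<Rightarrow> complex mat" where
  "u_end n a i = chevalley_e n i + b_coeff a (i - 1) \<cdot>\<^sub>m chevalley_f n (i - 1)"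

lemma u_carriers [simp]:
  "u_mid n a i \<in> carrier_mat n n" "u_end n a i \<in> carrier_mat n n"
  by (auto simp: u_mid_def u_end_def chevalley_e_def chevalley_f_def)

lemma index_u_end:
  assumes "1 \<le> i" "i < n" "r < n" "c < n"
  shows "u_end n a i $$ (r, c) =
      (if Suc r = i \<and> c = i then 1
       else if Suc r = i \<and> Suc (Suc c) = i then - a (i - 1) * a i else 0)"
  using assms by (auto simp: u_end_def b_coeff_def chevalley_e_def chevalley_f_def)

text \<open>Conjugation is handled as T A = B T, which avoids inverses: T on the left is a row
  operation, on the right a column operation, so entries can be compared.\<close>

lemma addrow_mat_intertwine:
  assumes "A \<in> carrier_mat n n" "B \<in> carrier_mat n n" "k < n" "l < n"
    and "\<And>r c. r < n \<Longrightarrow> c < n \<Longrightarrow>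
      (if r = k then t * A $$ (l, c) else 0) + A $$ (r, c) =
      (if c = l then t * B $$ (r, k) else 0) + B $$ (r, c)"
  shows "addrow_mat n t k l * A = B * (addrow_mat n t k l :: complex mat)"
proof -
  have "addrow t k l A = addcol t l k B"
  proof (rule eq_matI)
    fix r c
    assume "r < dim_row (addcol t l k B)" and "c < dim_col (addcol t l k B)"
    then have "r < n" "c < n"
      using assms(2) by auto
    then show "addrow t k l A $$ (r, c) = addcol t l k B $$ (r, c)"
      using assms(1-4) assms(5)[of r c] by (auto split: if_splits)
  qed (use assms in auto)
  then show ?thesis
    using assms by (simp add: addrow_mat[of _ n n] addcol_mat[of _ n n])
qed

text \<open>All nonzero entries of \<open>u_elt n a i\<close> have row and column in {i - 1, i}, so
  row \<open>k - 1\<close> and column \<open>k\<close> vanish.\<close>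

lemma intertwine_below:
  assumes "1 \<le> k" "Suc k < i" "i < n"
  shows "addrow_mat n t k (k - 1) * u_elt n a i = u_elt n a i * addrow_mat n t k (k - 1)"
  using assms by (intro addrow_mat_intertwine) (auto simp: index_u_elt)

text \<open>Row \<open>i - 2\<close> of \<open>u_elt n a i\<close> is zero, so the row operation
  changes nothing. The extra terms of \<open>u_mid\<close> are \<open>- a (i - 1)\<close> times
  column \<open>i - 1\<close>, which the column operation cancels.\<close>

lemma intertwine_pred:
  assumes "1 \<le> k" "Suc k = i" "i < n"
  shows "addrow_mat n (a k) k (k - 1) * u_elt n a i = u_mid n a i * addrow_mat n (a k) k (k - 1)"
  using assms
  by (intro addrow_mat_intertwine) (auto simp: index_u_elt u_mid_def)

text \<open>Row \<open>i\<close> of \<open>u_mid\<close> is \<open>- a i\<close> times row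
  \<open>i - 1\<close>, so the row operation clears it. The surviving diagonal entry
  \<open>a i\<close> is what the column operation creates from the entry 1 of
  \<open>u_end\<close>.\<close>

lemma intertwine_same:
  assumes "1 \<le> i" "i < n" "a 0 = 0"
  shows "addrow_mat n (a i) i (i - 1) * u_mid n a i = u_end n a i * addrow_mat n (a i) i (i - 1)"
  using assms
  by (intro addrow_mat_intertwine)
    (auto simp: index_u_elt index_u_end u_mid_def power2_eq_square)

text \<open>The nonzero entries of \<open>u_end\<close> lie in row \<open>i - 1\<close> and in
  columns \<open>i - 2\<close> and \<open>i\<close>, so row \<open>k - 1\<close> and column
  \<open>k\<close> vanish.\<close>

lemma intertwine_above:
  assumes "1 \<le> i" "i < k" "k < n"
  shows "addrow_mat n t k (k - 1) * u_end n a i = u_end n a i * addrow_mat n t k (k - 1)"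
  using assms
  by (intro addrow_mat_intertwine) (auto simp: index_u_end)

lemma exp_f_prod_u_elt:
  assumes i: "1 \<le> i" "i < n" and a0: "a 0 = 0" and "m < n"
  shows "exp_f_prod n a m * u_elt n a i =
    (if Suc m < i then u_elt n a i else if m < i then u_mid n a i else u_end n a i)
      * exp_f_prod n a m"
  using \<open>m < n\<close>
proof (induction m)
  case 0
  \<comment> \<open>For \<open>i = 1\<close> the empty product already falls into the
    \<open>u_mid\<close> branch.\<close>
  have "u_mid n a 1 = u_elt n a 1"
    by (intro eq_matI) (auto simp: u_mid_def u_elt_def lie_bracket_def chevalley_e_def chevalley_f_def)
  moreover have "i = 1 \<or> 1 < i"
    using i by auto
  ultimately show ?case
    using i left_mult_one_mat[OF u_elt_carrier] right_mult_one_mat[OF u_elt_carrier] by auto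
next
  case (Suc m)
  let ?T = "addrow_mat n (a (Suc m)) (Suc m) (Suc m - 1)" and ?P = "exp_f_prod n a m"
  let ?V = "\<lambda>m. if Suc m < i then u_elt n a i else if m < i then u_mid n a i else u_end n a i"
  have carr: "?T \<in> carrier_mat n n" "?P \<in> carrier_mat n n" "\<And>m. ?V m \<in> carrier_mat n n"
    using exp_f_prod_special_linear[of m n a] Suc.prems by (auto simp: special_linear_group_def)
  have step: "?T * ?V m = ?V (Suc m) * ?T"
  proof -
    \<comment> \<open>The new factor has index \<open>Suc m\<close>: below \<open>i - 1\<close>,
      equal to \<open>i - 1\<close>, equal to \<open>i\<close>, or above \<open>i\<close>.\<close>
    consider "Suc (Suc m) < i" | "Suc (Suc m) = i" | "Suc m = i" | "i < Suc m"
      by linarith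
    then show ?thesis
    proof cases
      case 1
      then show ?thesis using intertwine_below[of "Suc m" i n] i by simp
    next
      case 2
      then show ?thesis using intertwine_pred[of "Suc m" i n a] i by auto
    next
      case 3
      then show ?thesis using intertwine_same[of i n a] i a0 by auto
    next
      case 4
      then show ?thesis using intertwine_above[of i "Suc m" n] i Suc.prems by auto
    qed
  qed
  have "exp_f_prod n a (Suc m) * u_elt n a i = ?T * (?P * u_elt n a i)"
    using assoc_mult_mat[OF carr(1,2) u_elt_carrier] Suc.prems by (simp add: mat_exp_chevalley_f)
  also have "\<dots> = ?T * (?V m * ?P)"
    using Suc by simp
  also have "\<dots> = (?T * ?V m) * ?P"
    using assoc_mult_mat[OF carr(1) carr(3)[of m] carr(2)] by simp
  also have "\<dots> = (?V (Suc m) * ?T) * ?P"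
    by (simp only: step)
  also have "\<dots> = ?V (Suc m) * (?T * ?P)"
    by (rule assoc_mult_mat[OF carr(3) carr(1) carr(2)])
  also have "?T * ?P = exp_f_prod n a (Suc m)"
    using Suc.prems by (simp add: mat_exp_chevalley_f)
  finally show ?case .
qed

text \<open>Determinant 1 makes \<open>g\<close> a unit, so \<open>mat_inverse\<close> is not
  \<open>None\<close> and \<open>the\<close> yields a genuine inverse.\<close>

lemma mat_inverse_special_linear:
  assumes "g \<in> special_linear_group n"
  shows "the (mat_inverse g) \<in> carrier_mat n n" "g * the (mat_inverse g) = 1\<^sub>m n"
proof -
  have g: "g \<in> carrier_mat n n" "det g \<noteq> 0"
    using assms by (auto simp: special_linear_group_def)
  have "mat_inverse g \<noteq> None"
    using mat_inverse(1)[OF g(1), of undefined] det_non_zero_imp_unit[OF g, of undefined] by blast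
  then obtain h where "mat_inverse g = Some h"
    by blast
  then show "the (mat_inverse g) \<in> carrier_mat n n" "g * the (mat_inverse g) = 1\<^sub>m n"
    using mat_inverse(2)[OF g(1)] by auto
qed

theorem theorem1p4:
  fixes n :: nat and a :: "nat \<Rightarrow> complex"
  assumes "n \<ge> 2"
    and "a 0 = 0"
  shows "g_elt n a \<in> special_linear_group n \<and>
    (\<forall>i\<in>{1..n - 1}.
      g_elt n a * u_elt n a i * the (mat_inverse (g_elt n a)) =
        chevalley_e n i + b_coeff a (i - 1) \<cdot>\<^sub>m chevalley_f n (i - 1))"
proof (intro conjI ballI)
  show g: "g_elt n a \<in> special_linear_group n"
    unfolding g_elt_def using assms by (intro exp_f_prod_special_linear) auto
  fix i
  assume "i \<in> {1..n - 1}"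
  \<comment> \<open>As \<open>i\<close> is at most \<open>n - 1\<close>, the full product is in the
    last branch; it remains to multiply by the inverse on the right.\<close>
  then have "g_elt n a * u_elt n a i = u_end n a i * g_elt n a"
    using exp_f_prod_u_elt[of i n a "n - 1"] assms by (auto simp: g_elt_def)
  then have "g_elt n a * u_elt n a i * the (mat_inverse (g_elt n a)) =
      u_end n a i * g_elt n a * the (mat_inverse (g_elt n a))"
    by simp
  also have "\<dots> = u_end n a i * (g_elt n a * the (mat_inverse (g_elt n a)))"
    using g mat_inverse_special_linear[OF g]
    by (intro assoc_mult_mat[of _ n n _ n _ n]) (auto simp: special_linear_group_def)
  also have "\<dots> = u_end n a i"
    using mat_inverse_special_linear[OF g] right_mult_one_mat[OF u_carriers(2)] by simp
  finally show "g_elt n a * u_elt n a i * the (mat_inverse (g_elt n a)) =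
      chevalley_e n i + b_coeff a (i - 1) \<cdot>\<^sub>m chevalley_f n (i - 1)"
    by (simp add: u_end_def)
qed

end
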